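(* Let $A\in M_n(\mathbb C)$ and let $u\in\mathbb C^n$ be a unit vector. Put $z=z_A(u)$, $R=R_A(u)$, $\rho=\rho_A(u)$. With the metric normalization described in the context, the horizontal gradient of $\rho_A$ at $u$ is \[ g_A(u)=2\bigl(A^*R-\overline zR-\rho u\bigr). \] Thus the negative gradient flow and its retracted Euler discretization (with step $h>0$) are \[ \dot u=-g_A(u),\qquad u_{k+1}=\frac{u_k-hg_A(u_k)}{\|u_k-hg_A(u_k)\|}. \] Along the exact flow, $\dot\rho_A=-\|g_A\|^2$. Computing $g_A(u)$ requires one application of $A$ and one of $A^*$. If $A$ is normal, then \[ \operatorname{dist}\bigl(z_A(u),\operatorname{Spec}(A)\bigr)\le\sqrt{\rho_A(u)}. \]
   Context: For a unit vector $u\in\mathbb C^n$: $z_A(u)=u^*Au$, $R_A(u)=Au-z_A(u)u$, $\rho_A(u)=\|R_A(u)\|^2$. The function $\rho_A$ is invariant under $u\mapsto e^{i\theta}u$ and is regarded as a function on $\mathbb{CP}^{n-1}$. The tangent space at $[u]$ is identified with the horizontal space $H_u=\{h\in\mathbb C^n:u^*h=0\}$, with the Fubini--Study metric normalized as $\langle h,h'\rangle=\operatorname{Re}(h^*h')$. The horizontal gradient is the vector $g_A(u)\in H_u$ with $D\rho_A(u)[h]=\operatorname{Re}(h^*g_A(u))$ for all $h\in H_u$. $\operatorname{Spec}(A)$ is the set of eigenvalues of $A$ and $\operatorname{dist}$ is Euclidean distance in $\mathbb C$. *)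

theory Defs
  imports "HOL-Analysis.Analysis"
begin

text \<open>The product \<open>x\<^sup>*y\<close>, conjugate linear in the first argument.\<close>

definition hprod :: "complex ^ 'n \<Rightarrow> complex ^ 'n \<Rightarrow> complex" where
  "hprod x y = (\<Sum>i\<in>UNIV. cnj (x $ i) * y $ i)"

definition conj_transpose :: "complex ^ 'n ^ 'm \<Rightarrow> complex ^ 'm ^ 'n" where
  "conj_transpose A = map_matrix cnj (transpose A)"

definition normal_matrix :: "complex ^ 'n ^ 'n \<Rightarrow> bool" where
  "normal_matrix A \<longleftrightarrow> conj_transpose A ** A = A ** conj_transpose A"

definition Spec :: "complex ^ 'n ^ 'n \<Rightarrow> complex set" where
  "Spec A = {c. \<exists>v. v \<noteq> 0 \<and> A *v v = c *s v}"

definition rayleigh :: "complex ^ 'n ^ 'n \<Rightarrow> complex ^ 'n \<Rightarrow> complex" where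
  "rayleigh A u = hprod u (A *v u)"

definition residual :: "complex ^ 'n ^ 'n \<Rightarrow> complex ^ 'n \<Rightarrow> complex ^ 'n" where
  "residual A u = A *v u - rayleigh A u *s u"

text \<open>Only the values on the unit sphere matter below.\<close>

definition rho :: "complex ^ 'n ^ 'n \<Rightarrow> complex ^ 'n \<Rightarrow> real" where
  "rho A u = (norm (residual A u))\<^sup>2"

definition horizontal :: "complex ^ 'n \<Rightarrow> (complex ^ 'n) set" where
  "horizontal u = {h. hprod u h = 0}"

text \<open>
  A phase-invariant function \<open>f\<close> on the unit sphere is regarded as a function on projective space,
  and the tangent space at \<open>[u]\<close> is identified with \<open>horizontal u\<close>. Its differential
  at \<open>[u]\<close> is then the restriction to \<open>horizontal u\<close> of the derivative of \<open>f\<close> along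
  the sphere. A derivative \<open>D\<close> within the sphere is determined only on vectors tangent to the
  sphere at \<open>u\<close>, and these include \<open>horizontal u\<close>.
\<close>

definition is_horizontal_gradient ::
    "(complex ^ 'n \<Rightarrow> real) \<Rightarrow> complex ^ 'n \<Rightarrow> complex ^ 'n \<Rightarrow> bool" where
  "is_horizontal_gradient f u g \<longleftrightarrow> g \<in> horizontal u \<and>
     (\<exists>D. (f has_derivative D) (at u within sphere 0 1) \<and>
          (\<forall>h\<in>horizontal u. D h = Re (hprod h g)))"

definition horizontal_gradient ::
    "(complex ^ 'n \<Rightarrow> real) \<Rightarrow> complex ^ 'n \<Rightarrow> complex ^ 'n" where
  "horizontal_gradient f u = (THE g. is_horizontal_gradient f u g)"

text \<open>
  A curve in projective space is represented by its horizontal lift \<open>w\<close> to the unit sphere,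
  whose velocity is the tangent vector of the curve.
\<close>

definition neg_gradient_flow ::
    "(complex ^ 'n \<Rightarrow> real) \<Rightarrow> real set \<Rightarrow> (real \<Rightarrow> complex ^ 'n) \<Rightarrow> bool" where
  "neg_gradient_flow f T w \<longleftrightarrow> is_interval T \<and>
     (\<forall>t\<in>T. norm (w t) = 1 \<and>
        (\<exists>g. is_horizontal_gradient f (w t) g \<and>
             (w has_vector_derivative - g) (at t within T)))"

definition retract_sphere :: "complex ^ 'n \<Rightarrow> complex ^ 'n \<Rightarrow> complex ^ 'n" where
  "retract_sphere u h = (u + h) /\<^sub>R norm (u + h)"

definition retracted_euler ::
    "(complex ^ 'n \<Rightarrow> real) \<Rightarrow> real \<Rightarrow> (nat \<Rightarrow> complex ^ 'n) \<Rightarrow> bool" where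
  "retracted_euler f s U \<longleftrightarrow>
     (\<forall>k. norm (U k) = 1 \<and>
        (\<exists>g. is_horizontal_gradient f (U k) g \<and>
             U (Suc k) = retract_sphere (U k) (- (s *\<^sub>R g))))"

text \<open>
  Cost model for matrix-free computation: straight-line programs that access the matrix only by
  applying it or its conjugate transpose to a vector already computed. Each such application
  stores its result as a new entry at the end of the list of available vectors.
  All other operations are linear combinations, inner products and scalar arithmetic.
\<close>

datatype scalar_expr =
    SConst complex
  | SCnj scalar_expr
  | SAdd scalar_expr scalar_expr
  | SMult scalar_expr scalar_expr
  | SInner vector_expr vector_expr
and vector_expr =
    VVar nat
  | VAdd vector_expr vector_expr
  | VScale scalar_expr vector_expr

primrec scalar_val :: "(complex ^ 'n) list \<Rightarrow> scalar_expr \<Rightarrow> complex"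
  and vector_val :: "(complex ^ 'n) list \<Rightarrow> vector_expr \<Rightarrow> complex ^ 'n" where
  "scalar_val vs (SConst c) = c"
| "scalar_val vs (SCnj a) = cnj (scalar_val vs a)"
| "scalar_val vs (SAdd a b) = scalar_val vs a + scalar_val vs b"
| "scalar_val vs (SMult a b) = scalar_val vs a * scalar_val vs b"
| "scalar_val vs (SInner x y) = hprod (vector_val vs x) (vector_val vs y)"
| "vector_val vs (VVar i) = vs ! i"
| "vector_val vs (VAdd x y) = vector_val vs x + vector_val vs y"
| "vector_val vs (VScale a x) = scalar_val vs a *s vector_val vs x"

datatype mat_prog =
    Result vector_expr
  | Apply vector_expr mat_prog
  | ApplyAdj vector_expr mat_prog

primrec run_prog ::
    "complex ^ 'n ^ 'n \<Rightarrow> mat_prog \<Rightarrow> (complex ^ 'n) list \<Rightarrow> complex ^ 'n" where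
  "run_prog A (Result x) vs = vector_val vs x"
| "run_prog A (Apply x p) vs = run_prog A p (vs @ [A *v vector_val vs x])"
| "run_prog A (ApplyAdj x p) vs =
     run_prog A p (vs @ [conj_transpose A *v vector_val vs x])"

primrec applications :: "mat_prog \<Rightarrow> nat" where
  "applications (Result x) = 0"
| "applications (Apply x p) = Suc (applications p)"
| "applications (ApplyAdj x p) = applications p"

primrec adj_applications :: "mat_prog \<Rightarrow> nat" where
  "adj_applications (Result x) = 0"
| "adj_applications (Apply x p) = adj_applications p"
| "adj_applications (ApplyAdj x p) = Suc (adj_applications p)"

end

theory Submission
  imports Defs
begin

text \<open>
  Write \<open>z\<close>, \<open>R\<close>, \<open>\<rho>\<close> for the Rayleigh quotient, residual and squared residual at the unit vector
  \<open>u\<close>. In real coordinates \<open>\<rho>\<close> is a polynomial on the whole of \<open>\<complex>\<^sup>n\<close>, and its derivative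
  is \<open>h \<mapsto> 2 Re (R\<^sup>*(A h - z h - dz[h] u))\<close>. The variation of \<open>z\<close> drops out because \<open>R\<close> is
  orthogonal to \<open>u\<close>, which leaves \<open>Re (h\<^sup>* G)\<close> with \<open>G = 2 (A\<^sup>* R - cnj z R)\<close>. Since
  \<open>A u = R + z u\<close>, the component of \<open>G\<close> along \<open>u\<close> is \<open>2 u\<^sup>* A\<^sup>* R = 2 (A u)\<^sup>* R = 2 \<rho>\<close>, so
  subtracting \<open>2 \<rho> u\<close> projects \<open>G\<close> onto the horizontal space. This is the asserted gradient. It is
  the only one: every horizontal vector is the velocity of a great circle, and along such a curve
  the derivative within the sphere is determined.

  The statements on the flow and on the Euler scheme follow by substituting this gradient. Decay of
  \<open>\<rho>\<close> is the chain rule, where the velocity \<open>- g\<close> is horizontal and so the term \<open>2 \<rho> u\<close> separating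
  \<open>G\<close> from \<open>g\<close> contributes nothing. The iterates stay on the sphere because a horizontal step
  never reaches the origin. For the cost, the vectors \<open>A u\<close> and \<open>A\<^sup>* R\<close> are all that is
  needed: \<open>z\<close>, \<open>R\<close> and \<open>\<rho>\<close> are formed from \<open>u\<close> and \<open>A u\<close> alone.

  For normal \<open>A\<close>, put \<open>B = A - z\<close>, again normal. It suffices that the least value of
  \<open>\<parallel>B x\<parallel>\<close> on the unit sphere is \<open>\<bar>\<mu>\<bar>\<close> for an eigenvalue \<open>\<mu>\<close> of \<open>B\<close>, for then
  \<open>z + \<mu>\<close> is an eigenvalue of \<open>A\<close> and \<open>\<bar>\<mu>\<bar> \<le> \<parallel>B u\<parallel> = \<parallel>R\<parallel>\<close>. The maps
  \<open>B\<^sup>* B\<close>, \<open>B + B\<^sup>*\<close> and \<open>\<i> (B - B\<^sup>*)\<close> are self-adjoint and commute, so minimizing their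
  quadratic forms one after the other, each on the eigenspace found before, gives a common
  eigenvector. The last two maps make it an eigenvector of \<open>B\<close>, and the first makes
  \<open>\<bar>\<mu>\<bar>\<^sup>2\<close> the least value of \<open>\<parallel>B x\<parallel>\<^sup>2\<close>.
\<close>

section \<open>The Hermitian product and its real part\<close>

text \<open>
  The Euclidean structure that the library puts on complex vectors is the Fubini--Study normalization,
  so real derivatives and real self-adjointness can be read off from the Hermitian product.
\<close>

lemma inner_eq_Re_hprod: "x \<bullet> y = Re (hprod x y)" for x y :: "complex ^ 'n"
  by (simp add: inner_vec_def hprod_def inner_complex_def)

lemma hprod_self: "hprod x x = complex_of_real ((norm x)\<^sup>2)" for x :: "complex ^ 'n"
proof (rule complex_eqI)
  show "Re (hprod x x) = Re (complex_of_real ((norm x)\<^sup>2))"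
    by (simp add: power2_norm_eq_inner inner_eq_Re_hprod)
  show "Im (hprod x x) = Im (complex_of_real ((norm x)\<^sup>2))"
    by (simp add: hprod_def algebra_simps)
qed

lemma scaleR_eq_scalar_mult: "c *\<^sub>R x = complex_of_real c *s x" for x :: "complex ^ 'n"
  by (simp add: vec_eq_iff) (simp add: scaleR_conv_of_real)

lemma hprod_cnj: "cnj (hprod x y) = hprod y x" for x y :: "complex ^ 'n"
  by (simp add: hprod_def mult.commute)

lemma hprod_add_left: "hprod (x + y) z = hprod x z + hprod y z"
  and hprod_add_right: "hprod z (x + y) = hprod z x + hprod z y"
  and hprod_diff_left: "hprod (x - y) z = hprod x z - hprod y z"
  and hprod_diff_right: "hprod z (x - y) = hprod z x - hprod z y"
  and hprod_scale_left: "hprod (c *s x) z = cnj c * hprod x z"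
  and hprod_scale_right: "hprod z (c *s x) = c * hprod z x"
  for x y z :: "complex ^ 'n"
  by (simp_all add: hprod_def algebra_simps sum.distrib sum_subtractf sum_distrib_left)

lemmas hprod_simps =
  hprod_add_left hprod_add_right hprod_diff_left hprod_diff_right hprod_scale_left hprod_scale_right

lemma hprod_adjoint: "hprod x (A *v y) = hprod (conj_transpose A *v x) y"
  for A :: "complex ^ 'n ^ 'm"
proof -
  have "hprod x (A *v y) = (\<Sum>i\<in>UNIV. \<Sum>j\<in>UNIV. cnj (x $ i) * (A $ i $ j * y $ j))"
    by (simp add: hprod_def matrix_vector_mult_def sum_distrib_left)
  also have "\<dots> = (\<Sum>j\<in>UNIV. \<Sum>i\<in>UNIV. cnj (x $ i) * (A $ i $ j * y $ j))"
    by (rule sum.swap)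
  also have "\<dots> = hprod (conj_transpose A *v x) y"
    by (simp add: hprod_def matrix_vector_mult_def conj_transpose_def map_matrix_def transpose_def
        sum_distrib_right sum_distrib_left mult_ac)
  finally show ?thesis .
qed

lemma bounded_bilinear_hprod:
  "bounded_bilinear (hprod :: complex ^ 'n \<Rightarrow> complex ^ 'n \<Rightarrow> complex)"
proof -
  have "bilinear (hprod :: complex ^ 'n \<Rightarrow> complex ^ 'n \<Rightarrow> complex)"
    unfolding bilinear_def
    by (auto intro!: linearI simp: hprod_simps scaleR_eq_scalar_mult) (auto simp: scaleR_conv_of_real)
  then show ?thesis by (simp add: bilinear_conv_bounded_bilinear)
qed

lemma bounded_bilinear_scalar_mult:
  "bounded_bilinear ((*s) :: complex \<Rightarrow> complex ^ 'n \<Rightarrow> complex ^ 'n)"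
proof -
  have "bilinear ((*s) :: complex \<Rightarrow> complex ^ 'n \<Rightarrow> complex ^ 'n)"
    unfolding bilinear_def
    by (auto intro!: linearI simp: vec_eq_iff algebra_simps) 
  then show ?thesis by (simp add: bilinear_conv_bounded_bilinear)
qed

section \<open>The horizontal gradient\<close>

definition rho_gradient :: "complex ^ 'n ^ 'n \<Rightarrow> complex ^ 'n \<Rightarrow> complex ^ 'n" where
  "rho_gradient A u = 2 *s (conj_transpose A *v residual A u
     - cnj (rayleigh A u) *s residual A u - complex_of_real (rho A u) *s u)"

lemma hprod_residual_self:
  assumes "norm u = 1"
  shows "hprod u (residual A u) = 0"
  using assms by (simp add: residual_def hprod_simps hprod_self rayleigh_def)

text \<open>
  This is where the coefficient \<open>\<rho>\<close> of \<open>u\<close> comes from: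
  \<open>u\<^sup>* A\<^sup>* R = (R + z u)\<^sup>* R = \<parallel>R\<parallel>\<^sup>2\<close>.
\<close>

lemma rho_gradient_horizontal:
  assumes "norm u = 1"
  shows "rho_gradient A u \<in> horizontal u"
proof -
  have "hprod (A *v u) (residual A u)
    = hprod (residual A u + rayleigh A u *s u) (residual A u)"
    by (simp add: residual_def)
  also have "\<dots> = complex_of_real (rho A u)"
    using hprod_residual_self[OF assms] by (simp add: hprod_simps hprod_self rho_def)
  finally have "hprod u (conj_transpose A *v residual A u) = complex_of_real (rho A u)"
    by (metis hprod_adjoint hprod_cnj complex_cnj_complex_of_real)
  then show ?thesis
    using assms hprod_residual_self[OF assms]
    by (simp add: rho_gradient_def horizontal_def hprod_simps hprod_self)
qed

lemma residual_has_derivative: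
  "(residual A has_derivative (\<lambda>h. A *v h -
      (rayleigh A u *s h + (hprod u (A *v h) + hprod h (A *v u)) *s u))) (at u)"
proof -
  note A = bounded_linear_imp_has_derivative[OF matrix_vector_mul_bounded_linear[of A], of "at u"]
  have z: "(rayleigh A has_derivative (\<lambda>h. hprod u (A *v h) + hprod h (A *v u))) (at u)"
    unfolding rayleigh_def[abs_def]
    by (rule bounded_bilinear.FDERIV[OF bounded_bilinear_hprod has_derivative_ident A])
  show ?thesis
    unfolding residual_def[abs_def]
    by (rule has_derivative_diff[OF A
          bounded_bilinear.FDERIV[OF bounded_bilinear_scalar_mult z has_derivative_ident]])
qed

text \<open>
  The derivative is taken in the ambient space, where the chain rule applies to any curve. There the
  gradient is not yet horizontal and carries the extra multiple of \<open>u\<close>. It is invisible on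
  horizontal directions.
\<close>

lemma rho_has_derivative:
  assumes "norm u = 1"
  shows "(rho A has_derivative
    (\<lambda>h. Re (hprod h (rho_gradient A u + (2 * complex_of_real (rho A u)) *s u)))) (at u)"
proof -
  let ?D = "\<lambda>h. A *v h - (rayleigh A u *s h + (hprod u (A *v h) + hprod h (A *v u)) *s u)"
  have "rho A = (\<lambda>x. residual A x \<bullet> residual A x)"
    by (simp add: fun_eq_iff rho_def power2_norm_eq_inner)
  moreover have "((\<lambda>x. residual A x \<bullet> residual A x) has_derivative
      (\<lambda>h. residual A u \<bullet> ?D h + ?D h \<bullet> residual A u)) (at u)"
    by (rule has_derivative_inner[OF residual_has_derivative residual_has_derivative])
  moreover have "residual A u \<bullet> ?D h + ?D h \<bullet> residual A u
      = Re (hprod h (rho_gradient A u + (2 * complex_of_real (rho A u)) *s u))" for h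
  proof -
    let ?R = "residual A u"
    let ?G = "conj_transpose A *v ?R - cnj (rayleigh A u) *s ?R"
    have "rho_gradient A u + (2 * complex_of_real (rho A u)) *s u = 2 *s ?G"
      by (simp add: rho_gradient_def vec_eq_iff algebra_simps)
    then have "Re (hprod h (rho_gradient A u + (2 * complex_of_real (rho A u)) *s u))
        = 2 * (h \<bullet> ?G)"
      by (simp only: inner_eq_Re_hprod hprod_scale_right) simp
    also have "h \<bullet> ?G = ?G \<bullet> h" by (rule inner_commute)
    \<comment> \<open>the variation of the Rayleigh quotient is a multiple of \<open>u\<close>, to which the residual is orthogonal\<close>
    also have "\<dots> = ?R \<bullet> ?D h"
      using hprod_residual_self[OF assms, of A] hprod_cnj[of u ?R]
      by (simp add: inner_eq_Re_hprod hprod_simps hprod_adjoint)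
    finally show ?thesis by (simp only: inner_commute[of "?D h"])
  qed
  ultimately show ?thesis by simp
qed

text \<open>
  A derivative within the sphere says nothing about directions that no curve in the sphere attains.
  Great circles attain every horizontal direction, which is what makes the gradient unique.
\<close>

lemma great_circle_tangent:
  fixes u h :: "complex ^ 'n"
  assumes u: "norm u = 1" and h: "h \<in> horizontal u"
  obtains c where "\<And>t. c t \<in> sphere 0 1" "c 0 = u" "(c has_vector_derivative h) (at 0)"
proof -
  \<comment> \<open>for \<open>h = 0\<close> the sign is \<open>0\<close> and the curve is constant\<close>
  define e where "e = sgn h"
  define c where "c t = cos (norm h * t) *\<^sub>R u + sin (norm h * t) *\<^sub>R e" for t
  have uh: "u \<bullet> h = 0" using h by (simp add: horizontal_def inner_eq_Re_hprod)
  show thesis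
  proof (rule that)
    show "c t \<in> sphere 0 1" for t
    proof (cases "h = 0")
      case False
      have "(norm (c t))\<^sup>2 = (cos (norm h * t))\<^sup>2 * (u \<bullet> u) + (sin (norm h * t))\<^sup>2 * (e \<bullet> e)"
      proof -
        have "u \<bullet> e = 0" "e \<bullet> u = 0"
          using uh by (simp_all add: e_def sgn_div_norm inner_commute)
        then show ?thesis
          unfolding power2_norm_eq_inner by (simp add: c_def inner_simps power2_eq_square)
      qed
      also have "\<dots> = 1"
        using u False by (simp add: e_def norm_sgn flip: power2_norm_eq_inner)
      finally show ?thesis by (simp add: power2_eq_1_iff) (smt (verit) norm_ge_zero)
    qed (simp add: c_def u)
    show "c 0 = u" by (simp add: c_def)
    have "(c has_vector_derivative (- sin (norm h * 0) * norm h) *\<^sub>R u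
        + (cos (norm h * 0) * norm h) *\<^sub>R e) (at 0)"
      unfolding c_def[abs_def]
      by (auto intro!: derivative_eq_intros simp: has_vector_derivative_def algebra_simps)
    then show "(c has_vector_derivative h) (at 0)"
      by (cases "h = 0") (simp_all add: e_def sgn_div_norm)
  qed
qed

lemma horizontal_gradient_unique:
  assumes u: "norm u = 1"
    and g: "is_horizontal_gradient f u g" and g': "is_horizontal_gradient f u g'"
  shows "g = g'"
proof -
  obtain D D' where D: "(f has_derivative D) (at u within sphere 0 1)"
      "\<And>h. h \<in> horizontal u \<Longrightarrow> D h = Re (hprod h g)"
    and D': "(f has_derivative D') (at u within sphere 0 1)"
      "\<And>h. h \<in> horizontal u \<Longrightarrow> D' h = Re (hprod h g')"
    using g g' unfolding is_horizontal_gradient_def by metis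
  have gh: "g - g' \<in> horizontal u"
    using g g' by (simp add: is_horizontal_gradient_def horizontal_def hprod_simps)
  obtain c where c: "\<And>t. c t \<in> sphere 0 1" "c 0 = u"
    "(c has_vector_derivative g - g') (at 0)"
    using great_circle_tangent[OF u gh] by metis
  have along: "((\<lambda>t. f (c t)) has_derivative (\<lambda>t. E (t *\<^sub>R (g - g')))) (at 0)"
    if "(f has_derivative E) (at u within sphere 0 1)" for E
  proof (rule has_derivative_in_compose[where f = c and g = f])
    show "(c has_derivative (\<lambda>t. t *\<^sub>R (g - g'))) (at 0)"
      using c(3) by (simp add: has_vector_derivative_def)
    show "(f has_derivative E) (at (c 0) within range c)"
      using that c(1,2) by (auto intro: has_derivative_subset)
  qed
  have "D (g - g') = D' (g - g')"
    using fun_cong[OF has_derivative_unique[OF along[OF D(1)] along[OF D'(1)]], of 1] by simp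
  then have "(g - g') \<bullet> (g - g') = 0"
    using D(2)[OF gh] D'(2)[OF gh] by (simp add: inner_eq_Re_hprod hprod_diff_right)
  then show ?thesis by simp
qed

lemma is_horizontal_gradient_rho:
  assumes "norm u = 1"
  shows "is_horizontal_gradient (rho A) u (rho_gradient A u)"
  unfolding is_horizontal_gradient_def
proof (intro conjI exI ballI)
  show "rho_gradient A u \<in> horizontal u"
    by (rule rho_gradient_horizontal[OF assms])
  show "(rho A has_derivative
    (\<lambda>h. Re (hprod h (rho_gradient A u + (2 * complex_of_real (rho A u)) *s u))))
    (at u within sphere 0 1)"
    by (rule has_derivative_at_withinI[OF rho_has_derivative[OF assms]])
  fix h assume "h \<in> horizontal u"
  then have "hprod h u = 0" by (metis (mono_tags) horizontal_def mem_Collect_eq hprod_cnj complex_cnj_zero)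
  then show "Re (hprod h (rho_gradient A u + (2 * complex_of_real (rho A u)) *s u))
      = Re (hprod h (rho_gradient A u))"
    by (simp add: hprod_simps)
qed

lemma is_horizontal_gradient_rho_iff:
  assumes "norm u = 1"
  shows "is_horizontal_gradient (rho A) u g \<longleftrightarrow> g = rho_gradient A u"
  using is_horizontal_gradient_rho[OF assms] horizontal_gradient_unique[OF assms] by blast

lemma horizontal_gradient_rho:
  assumes "norm u = 1"
  shows "horizontal_gradient (rho A) u = rho_gradient A u"
  by (simp add: horizontal_gradient_def is_horizontal_gradient_rho_iff[OF assms])

section \<open>The gradient flow and its Euler discretization\<close>

lemma rho_along_flow:
  assumes w: "neg_gradient_flow (rho A) T w" and t: "t \<in> T"
  shows "((\<lambda>s. rho A (w s)) has_real_derivative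
           - (norm (horizontal_gradient (rho A) (w t)))\<^sup>2) (at t within T)"
proof -
  let ?g = "rho_gradient A (w t)"
  have n: "norm (w t) = 1" and
    dw: "(w has_vector_derivative - ?g) (at t within T)"
    using w t is_horizontal_gradient_rho_iff[of "w t" A] by (auto simp: neg_gradient_flow_def)
  have gw: "hprod ?g (w t) = 0"
    using rho_gradient_horizontal[OF n, of A]
    by (metis (mono_tags) horizontal_def mem_Collect_eq hprod_cnj complex_cnj_zero)
  have "((\<lambda>s. rho A (w s)) has_derivative (\<lambda>s. Re (hprod (s *\<^sub>R - ?g)
      (?g + (2 * complex_of_real (rho A (w t))) *s w t)))) (at t within T)"
    by (rule has_derivative_compose[where g = "rho A" and f = w,
          OF dw[unfolded has_vector_derivative_def] rho_has_derivative[OF n]])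
  moreover have "Re (hprod (s *\<^sub>R - ?g) (?g + (2 * complex_of_real (rho A (w t))) *s w t))
      = - (norm ?g)\<^sup>2 * s" for s
  proof -
    have "s *\<^sub>R - ?g = complex_of_real (- s) *s ?g" by (simp flip: scaleR_eq_scalar_mult)
    then have "Re (hprod (s *\<^sub>R - ?g) (?g + (2 * complex_of_real (rho A (w t))) *s w t))
        = Re (hprod (complex_of_real (- s) *s ?g) (?g + (2 * complex_of_real (rho A (w t))) *s w t))"
      by (simp only:)
    also have "\<dots> = - (norm ?g)\<^sup>2 * s"
      using gw by (simp add: hprod_scale_left hprod_add_right hprod_scale_right hprod_self
          del: of_real_minus vector_smult_lneg)
    finally show ?thesis .
  qed
  ultimately show ?thesis
    unfolding has_field_derivative_def horizontal_gradient_rho[OF n] by (simp only:)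
qed

text \<open>
  Horizontality keeps the step away from the origin, where normalization would return \<open>0\<close>: the component
  along \<open>u\<close> stays \<open>1\<close>.
\<close>

lemma retract_horizontal_unit:
  assumes u: "norm u = 1" and g: "g \<in> horizontal u"
  shows "norm ((u - s *\<^sub>R g) /\<^sub>R norm (u - s *\<^sub>R g)) = 1"
proof -
  have "hprod u (u - s *\<^sub>R g) = 1"
    using u g by (simp add: hprod_simps scaleR_eq_scalar_mult hprod_self horizontal_def)
  then have "u - s *\<^sub>R g \<noteq> 0" by (auto simp: hprod_def)
  then show ?thesis by simp
qed

lemma retracted_euler_rho_iff:
  "retracted_euler (rho A) h U \<longleftrightarrow> norm (U 0) = 1 \<and>
     (\<forall>k. U (Suc k) = (U k - h *\<^sub>R horizontal_gradient (rho A) (U k))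
             /\<^sub>R norm (U k - h *\<^sub>R horizontal_gradient (rho A) (U k)))" (is "_ \<longleftrightarrow> ?R")
proof
  show ?R if "retracted_euler (rho A) h U"
    using that unfolding retracted_euler_def retract_sphere_def
    by (metis is_horizontal_gradient_rho_iff horizontal_gradient_rho add_uminus_conv_diff)
  show "retracted_euler (rho A) h U" if R: ?R
  proof -
    have "norm (U k) = 1" for k
    proof (induction k)
      case (Suc k)
      then show ?case
        using R retract_horizontal_unit[OF Suc rho_gradient_horizontal[OF Suc, of A], of h]
        by (simp only: horizontal_gradient_rho)
    qed (use R in blast)
    then show ?thesis
      using R by (auto simp: retracted_euler_def retract_sphere_def is_horizontal_gradient_rho_iff
        horizontal_gradient_rho)
  qed
qed

section \<open>The cost of the gradient\<close>

text \<open>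
  The expressions below are to be read in a run started on a single vector \<open>u\<close>: slot \<open>0\<close> holds
  \<open>u\<close>, slot \<open>1\<close> holds \<open>A u\<close>, and slot \<open>2\<close> will hold \<open>A\<^sup>* R\<close>.
  Recomputing the residual inside an expression costs no application of the matrix.
\<close>

definition residual_expr :: vector_expr where
  "residual_expr = VAdd (VVar 1)
     (VScale (SMult (SConst (- 1)) (SInner (VVar 0) (VVar 1))) (VVar 0))"

definition gradient_prog :: mat_prog where
  "gradient_prog = Apply (VVar 0) (ApplyAdj residual_expr (Result
     (VScale (SConst 2) (VAdd (VAdd (VVar 2)
        (VScale (SMult (SConst (- 1)) (SCnj (SInner (VVar 0) (VVar 1)))) residual_expr))
        (VScale (SMult (SConst (- 1)) (SInner residual_expr residual_expr)) (VVar 0))))))"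

lemma run_gradient_prog: "run_prog B gradient_prog [v] = rho_gradient B v"
proof -
  have "vector_val [v, B *v v] residual_expr = residual B v"
    and "\<And>y. vector_val [v, B *v v, y] residual_expr = residual B v"
    by (simp_all add: residual_expr_def residual_def rayleigh_def)
  then show ?thesis
    by (simp add: gradient_prog_def rho_gradient_def hprod_self rho_def rayleigh_def)
qed

section \<open>Normal matrices\<close>

text \<open>
  The Rayleigh principle on an invariant subspace. A minimizer \<open>v\<close> of the quadratic form on the unit
  sphere of \<open>S\<close> makes \<open>x \<bullet> f x - c (x \<bullet> x)\<close> nonnegative on \<open>S\<close> and zero at
  \<open>v\<close>. Its first variation at \<open>v\<close> in the direction \<open>d = f v - c v\<close>, which is in \<open>S\<close>
  by invariance, is \<open>2 (d \<bullet> d)\<close>, and so \<open>d\<close> must vanish.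
\<close>

lemma selfadjoint_least_eigenvector:
  fixes f :: "'a::euclidean_space \<Rightarrow> 'a"
  assumes f: "linear f" and sa: "\<And>x y. f x \<bullet> y = x \<bullet> f y"
    and S: "subspace S" "S \<noteq> {0}" and inv: "\<And>x. x \<in> S \<Longrightarrow> f x \<in> S"
  obtains v c where "v \<in> S" "norm v = 1" "f v = c *\<^sub>R v" "\<And>x. x \<in> S \<Longrightarrow> c * (x \<bullet> x) \<le> x \<bullet> f x"
proof -
  let ?K = "S \<inter> sphere 0 1"
  have "compact ?K" by (intro closed_Int_compact closed_subspace S compact_sphere)
  moreover obtain y where "y \<in> S" "y \<noteq> 0" using S subspace_0 by blast
  then have "sgn y \<in> ?K" by (auto simp: sgn_div_norm intro: subspace_scale[OF S(1)])
  then have "?K \<noteq> {}" by blast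
  moreover have "continuous_on ?K (\<lambda>x. x \<bullet> f x)"
    by (intro continuous_intros linear_continuous_on) (use f linear_conv_bounded_linear in blast)
  ultimately obtain v where v: "v \<in> S" "norm v = 1"
    and min: "\<And>x. x \<in> ?K \<Longrightarrow> v \<bullet> f v \<le> x \<bullet> f x"
    using continuous_attains_inf[of ?K "\<lambda>x. x \<bullet> f x"] by (auto simp del: Int_iff) force
  define c where "c = v \<bullet> f v"
  have low: "c * (x \<bullet> x) \<le> x \<bullet> f x" if x: "x \<in> S" for x
  proof (cases "x = 0")
    case False
    have "sgn x \<in> ?K" using x False by (auto simp: sgn_div_norm intro: subspace_scale[OF S(1)])
    then have "c \<le> sgn x \<bullet> f (sgn x)" unfolding c_def by (rule min)
    also have "\<dots> = (x \<bullet> f x) / (x \<bullet> x)"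
      by (simp add: sgn_div_norm linear_scale[OF f] field_simps power2_eq_square
          flip: power2_norm_eq_inner)
    finally show ?thesis using False by (simp add: field_simps)
  qed (simp add: linear_0[OF f])
  define d where "d = f v - c *\<^sub>R v"
  have d: "d \<in> S" unfolding d_def by (intro subspace_diff subspace_scale S inv v)
  define q where "q = d \<bullet> f d - c * (d \<bullet> d)"
  have q: "q \<ge> 0" using low[OF d] by (simp add: q_def)
  have line: "0 \<le> 2 * t * (d \<bullet> d) + t\<^sup>2 * q" for t
  proof -
    have "v + t *\<^sub>R d \<in> S" by (intro subspace_add subspace_scale S d v)
    from low[OF this]
    have "0 \<le> (v + t *\<^sub>R d) \<bullet> f (v + t *\<^sub>R d) - c * ((v + t *\<^sub>R d) \<bullet> (v + t *\<^sub>R d))" by simp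
    also have "\<dots> = (v \<bullet> f v - c * (v \<bullet> v)) + 2 * t * (d \<bullet> f v - c * (d \<bullet> v)) + t\<^sup>2 * q"
      using sa[of v d] by (simp add: linear_add[OF f] linear_scale[OF f] inner_simps q_def
          power2_eq_square algebra_simps inner_commute)
    also have "v \<bullet> f v - c * (v \<bullet> v) = 0" using v by (simp add: c_def norm_eq_1)
    also have "d \<bullet> f v - c * (d \<bullet> v) = d \<bullet> d"
      by (simp add: d_def inner_simps)
    finally show ?thesis by simp
  qed
  have "d \<bullet> d \<le> 0"
  proof -
    \<comment> \<open>the step \<open>- (d \<bullet> d) / q\<close> minimizes the quadratic; adding \<open>1\<close> avoids the case \<open>q = 0\<close>\<close>
    define m where "m = q + 1"
    have m: "m > 0" "q = m - 1" using q by (simp_all add: m_def)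
    let ?t = "- (d \<bullet> d) / m"
    have "2 * ?t * (d \<bullet> d) + ?t\<^sup>2 * q = - ((d \<bullet> d)\<^sup>2 * (m + 1) / m\<^sup>2)"
      using m(1) unfolding m(2) by (simp add: field_simps power2_eq_square)
    with line[of ?t] have "(d \<bullet> d)\<^sup>2 * (m + 1) / m\<^sup>2 \<le> 0" by simp
    then show ?thesis using m(1) by (auto simp: divide_le_0_iff mult_le_0_iff)
  qed
  then have "d = 0" using inner_ge_zero[of d] by (metis inner_eq_zero_iff order_antisym)
  then have "f v = c *\<^sub>R v" by (simp add: d_def)
  with v low show thesis by (intro that)
qed

text \<open>
  For a normal matrix the least singular value is the least modulus of an eigenvalue. Minimizing
  \<open>\<parallel>A x\<parallel>\<^sup>2 = x \<bullet> P x\<close> with \<open>P = A\<^sup>* A\<close> gives the bound, attained on an eigenspace of \<open>P\<close>.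
  Inside it a joint eigenvector of \<open>H = A + A\<^sup>*\<close> and \<open>K = \<i> (A - A\<^sup>*)\<close> is an
  eigenvector of \<open>A = (H - \<i> K) / 2\<close>. Each eigenspace is preserved by the maps
  that come later because \<open>A\<close> and \<open>A\<^sup>*\<close> commute, and hence so do \<open>P\<close>, \<open>H\<close>, \<open>K\<close>. All three maps are self-adjoint with real eigenvalues,
  and hence real subspaces and the real inner product suffice.
\<close>

lemma normal_least_eigenvalue:
  fixes A :: "complex ^ 'n ^ 'n"
  assumes "normal_matrix A"
  obtains v \<mu> where "norm v = 1" "A *v v = \<mu> *s v" "\<And>x. cmod \<mu> * norm x \<le> norm (A *v x)"
proof -
  let ?f = "\<lambda>x. A *v x" and ?g = "\<lambda>x. conj_transpose A *v x"
  define P where "P x = ?g (?f x)" for x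
  define H where "H x = ?f x + ?g x" for x
  define K where "K x = \<i> *s (?f x - ?g x)" for x
  have comm: "?g (?f x) = ?f (?g x)" for x
    using assms by (simp add: normal_matrix_def matrix_vector_mul_assoc)
  have adj: "x \<bullet> ?f y = ?g x \<bullet> y" for x y
    by (simp add: inner_eq_Re_hprod hprod_adjoint)
  have adj': "x \<bullet> ?g y = ?f x \<bullet> y" for x y
    by (metis adj inner_commute)
  have isum: "(\<i> *s x) \<bullet> y = - (x \<bullet> (\<i> *s y))" for x y :: "complex ^ 'n"
    by (simp add: inner_eq_Re_hprod hprod_simps)
  note mv = matrix_vector_right_distrib matrix_vector_mult_diff_distrib vector_scalar_commute
  have lin: "linear P" "linear H" "linear K"
    by (auto intro!: linearI simp: P_def H_def K_def mv scaleR_eq_scalar_mult vec_eq_iff algebra_simps)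
  have P_sa: "P x \<bullet> y = x \<bullet> P y" for x y by (simp add: P_def adj' flip: adj)
  have H_sa: "H x \<bullet> y = x \<bullet> H y" for x y by (simp add: H_def inner_simps adj adj')
  have K_sa: "K x \<bullet> y = x \<bullet> K y" for x y
  proof -
    have "K x \<bullet> y = - ((?f x - ?g x) \<bullet> (\<i> *s y))" by (simp only: K_def isum)
    also have "\<dots> = x \<bullet> (?f (\<i> *s y) - ?g (\<i> *s y))" by (simp add: inner_simps adj adj')
    finally show ?thesis by (simp add: K_def mv)
  qed
  have PH: "P (H x) = H (P x)" and PK: "P (K x) = K (P x)" and HK: "H (K x) = K (H x)" for x
    by (simp_all add: P_def H_def K_def mv comm algebra_simps)
  have sub: "subspace {x \<in> S. L x = c *\<^sub>R x}" if "subspace S" "linear L"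
    for S and L :: "complex ^ 'n \<Rightarrow> complex ^ 'n" and c :: real
    using that by (auto simp: subspace_def linear_0 linear_add linear_scale scaleR_add_right)
  obtain v0 p where v0: "norm v0 = 1" "P v0 = p *\<^sub>R v0" and p: "\<And>x. p * (x \<bullet> x) \<le> x \<bullet> P x"
    using selfadjoint_least_eigenvector[OF lin(1) P_sa subspace_UNIV] by (auto simp: UNIV_not_singleton)
  define E where "E = {x \<in> UNIV. P x = p *\<^sub>R x}"
  have E: "subspace E" unfolding E_def by (rule sub[OF subspace_UNIV lin(1)])
  have "v0 \<in> E" "v0 \<noteq> 0" using v0 by (auto simp: E_def)
  then have E0: "E \<noteq> {0}" by blast
  have EH: "H x \<in> E" if "x \<in> E" for x
    using that by (simp add: E_def PH linear_scale[OF lin(2)])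
  obtain v1 a where v1: "v1 \<in> E" "norm v1 = 1" "H v1 = a *\<^sub>R v1"
    by (rule selfadjoint_least_eigenvector[OF lin(2) H_sa E E0 EH])
  define F where "F = {x \<in> E. H x = a *\<^sub>R x}"
  have F: "subspace F" unfolding F_def by (rule sub[OF E lin(2)])
  have "v1 \<in> F" "v1 \<noteq> 0" using v1 by (auto simp: F_def)
  then have F0: "F \<noteq> {0}" by blast
  have FK: "K x \<in> F" if "x \<in> F" for x
    using that by (simp add: F_def E_def PK HK linear_scale[OF lin(3)])
  obtain v b where v: "v \<in> F" "norm v = 1" "K v = b *\<^sub>R v"
    by (rule selfadjoint_least_eigenvector[OF lin(3) K_sa F F0 FK])
  have vP: "P v = p *\<^sub>R v" and vH: "H v = a *\<^sub>R v"
    using v(1) by (simp_all add: F_def E_def)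
  define \<mu> where "\<mu> = (complex_of_real a - \<i> * complex_of_real b) / 2"
  have "2 *s ?f v = H v - \<i> *s K v" by (simp add: H_def K_def vec_eq_iff algebra_simps)
  also have "\<dots> = 2 *s (\<mu> *s v)"
    by (simp add: vH v(3) \<mu>_def scaleR_eq_scalar_mult vec_eq_iff algebra_simps)
  finally have ev: "?f v = \<mu> *s v" by (simp add: vec_eq_iff)
  have nP: "x \<bullet> P x = (norm (?f x))\<^sup>2" for x
    by (simp add: P_def adj' power2_norm_eq_inner)
  have "p = v \<bullet> P v" using v(2) by (simp add: vP norm_eq_1)
  also have "\<dots> = (norm (?f v))\<^sup>2" by (rule nP)
  also have "\<dots> = (\<mu> *s v) \<bullet> (\<mu> *s v)" by (simp only: ev power2_norm_eq_inner)
  also have "\<dots> = Re (cnj \<mu> * \<mu> * hprod v v)"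
    by (simp only: inner_eq_Re_hprod hprod_scale_left hprod_scale_right mult.assoc mult.left_commute)
  also have "\<dots> = (cmod \<mu>)\<^sup>2"
    using v(2) unfolding cmod_power2 by (simp add: hprod_self power2_eq_square)
  finally have p\<mu>: "p = (cmod \<mu>)\<^sup>2" .
  show thesis
  proof (rule that[OF v(2) ev])
    show "cmod \<mu> * norm x \<le> norm (A *v x)" for x
    proof (rule power2_le_imp_le)
      show "(cmod \<mu> * norm x)\<^sup>2 \<le> (norm (A *v x))\<^sup>2"
        using p[of x] unfolding nP p\<mu> power2_norm_eq_inner[symmetric] power_mult_distrib .
    qed simp
  qed
qed

lemma normal_matrix_shift:
  fixes A :: "complex ^ 'n ^ 'n"
  assumes "normal_matrix A"
  shows "normal_matrix (A - mat z)"
proof -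
  have comm: "conj_transpose A *v (A *v x) = A *v (conj_transpose A *v x)" for x
    using assms by (simp add: normal_matrix_def matrix_vector_mul_assoc)
  have m: "mat c *v x = c *s x" for c and x :: "complex ^ 'n"
    by (simp add: vec_eq_iff matrix_vector_mult_def mat_def if_distrib if_distribR cong: if_cong)
  have B: "conj_transpose (A - mat z) = conj_transpose A - mat (cnj z)"
    by (simp add: conj_transpose_def map_matrix_def transpose_def mat_def vec_eq_iff)
  show ?thesis
    unfolding normal_matrix_def B matrix_eq
    by (simp add: matrix_vector_mult_diff_rdistrib matrix_vector_mult_diff_distrib m comm
        vector_scalar_commute flip: matrix_vector_mul_assoc)
qed

lemma dist_Spec_le_normal:
  fixes A :: "complex ^ 'n ^ 'n"
  assumes "normal_matrix A" and u: "norm u = 1"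
  shows "infdist z (Spec A) \<le> norm (A *v u - z *s u)"
proof -
  have m: "(A - mat z) *v x = A *v x - z *s x" for x
    by (simp add: matrix_vector_mult_diff_rdistrib)
      (simp add: vec_eq_iff matrix_vector_mult_def mat_def if_distrib if_distribR cong: if_cong)
  obtain v \<mu> where v: "norm v = 1" "A *v v - z *s v = \<mu> *s v"
    and le: "\<And>x. cmod \<mu> * norm x \<le> norm (A *v x - z *s x)"
    using normal_least_eigenvalue[OF normal_matrix_shift[OF assms(1), of z]] unfolding m by metis
  have "A *v v = (z + \<mu>) *s v" using v(2) by (simp add: vec_eq_iff algebra_simps)
  moreover have "v \<noteq> 0" using v(1) by auto
  ultimately have "z + \<mu> \<in> Spec A" by (auto simp: Spec_def)
  then have "infdist z (Spec A) \<le> dist z (z + \<mu>)" by (rule infdist_le)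
  also have "\<dots> \<le> norm (A *v u - z *s u)" using le[of u] u by (simp add: dist_norm)
  finally show ?thesis .
qed

section \<open>Gradient, flow, cost and spectral bound\<close>

theorem proposition3p1:
  fixes A :: "complex ^ 'n ^ 'n" and u :: "complex ^ 'n"
  assumes "norm u = 1"
  shows
    "(\<exists>!g. is_horizontal_gradient (rho A) u g) \<and>
     (let z = rayleigh A u; R = residual A u; r = rho A u in
        horizontal_gradient (rho A) u
          = 2 *s (conj_transpose A *v R - cnj z *s R - complex_of_real r *s u)) \<and>
     (\<forall>T w. neg_gradient_flow (rho A) T w \<longleftrightarrow>
        is_interval T \<and>
        (\<forall>t\<in>T. norm (w t) = 1 \<and>
           (w has_vector_derivative - horizontal_gradient (rho A) (w t)) (at t within T))) \<and>
     (\<forall>h U. h > 0 \<longrightarrow>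
        (retracted_euler (rho A) h U \<longleftrightarrow>
         norm (U 0) = 1 \<and>
         (\<forall>k. U (Suc k) = (U k - h *\<^sub>R horizontal_gradient (rho A) (U k))
                 /\<^sub>R norm (U k - h *\<^sub>R horizontal_gradient (rho A) (U k))))) \<and>
     (\<forall>T w. neg_gradient_flow (rho A) T w \<longrightarrow>
        (\<forall>t\<in>T. ((\<lambda>s. rho A (w s)) has_real_derivative
                   - (norm (horizontal_gradient (rho A) (w t)))\<^sup>2) (at t within T))) \<and>
     (\<exists>p. applications p = 1 \<and> adj_applications p = 1 \<and>
        (\<forall>(B :: complex ^ 'n ^ 'n) v. norm v = 1 \<longrightarrow>
           run_prog B p [v] = horizontal_gradient (rho B) v)) \<and>
     (normal_matrix A \<longrightarrow> infdist (rayleigh A u) (Spec A) \<le> sqrt (rho A u))"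
proof (intro conjI)
  show "\<exists>!g. is_horizontal_gradient (rho A) u g"
    by (simp add: is_horizontal_gradient_rho_iff[OF assms])
  show "let z = rayleigh A u; R = residual A u; r = rho A u in
      horizontal_gradient (rho A) u
        = 2 *s (conj_transpose A *v R - cnj z *s R - complex_of_real r *s u)"
    by (simp add: horizontal_gradient_rho[OF assms] rho_gradient_def)
  show "\<forall>T w. neg_gradient_flow (rho A) T w \<longleftrightarrow>
      is_interval T \<and>
      (\<forall>t\<in>T. norm (w t) = 1 \<and>
         (w has_vector_derivative - horizontal_gradient (rho A) (w t)) (at t within T))"
    by (auto simp: neg_gradient_flow_def is_horizontal_gradient_rho_iff horizontal_gradient_rho)
  show "\<forall>h U. h > 0 \<longrightarrow>
      (retracted_euler (rho A) h U \<longleftrightarrow>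
       norm (U 0) = 1 \<and>
       (\<forall>k. U (Suc k) = (U k - h *\<^sub>R horizontal_gradient (rho A) (U k))
               /\<^sub>R norm (U k - h *\<^sub>R horizontal_gradient (rho A) (U k))))"
    by (intro allI impI retracted_euler_rho_iff)
  show "\<forall>T w. neg_gradient_flow (rho A) T w \<longrightarrow>
      (\<forall>t\<in>T. ((\<lambda>s. rho A (w s)) has_real_derivative
                 - (norm (horizontal_gradient (rho A) (w t)))\<^sup>2) (at t within T))"
    by (intro allI impI ballI rho_along_flow)
  have "applications gradient_prog = 1" "adj_applications gradient_prog = 1"
    by (simp_all add: gradient_prog_def)
  then show "\<exists>p. applications p = 1 \<and> adj_applications p = 1 \<and>
      (\<forall>(B :: complex ^ 'n ^ 'n) v. norm v = 1 \<longrightarrow>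
         run_prog B p [v] = horizontal_gradient (rho B) v)"
    by (intro exI[of _ gradient_prog]) (simp add: run_gradient_prog horizontal_gradient_rho)
  show "normal_matrix A \<longrightarrow> infdist (rayleigh A u) (Spec A) \<le> sqrt (rho A u)"
    using dist_Spec_le_normal[OF _ assms] by (simp add: rho_def residual_def)
qed

end
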